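(* Let $\phi = \forall x_1 \cdots \forall x_k \exists y_1 \cdots \exists y_l\, \theta$ be an $\mathcal{L}$-sentence with $\theta$ quantifier-free, and suppose that $\sigma:\mathbf{Var}(\phi)\to\mathbb{N}$ is a stratification of $\phi$ that assigns the same value to all of the variables $y_1,\ldots,y_l$. Then $\mathrm{NF}$ decides $\phi$, i.e. $\mathrm{NF}\vdash\phi$ or $\mathrm{NF}\vdash\neg\phi$.
   Context: $\mathcal{L}$ is the (single-sorted) first-order language of set theory with equality and one binary relation symbol $\in$. For an $\mathcal{L}$-formula $\phi$, $\mathbf{Var}(\phi)$ is the set of all variables (free and bound) appearing in $\phi$. A stratification of $\phi$ is a function $\sigma:\mathbf{Var}(\phi)\to\mathbb{N}$ such that (i) if $x\in y$ is a subformula of $\phi$ then $\sigma(y)=\sigma(x)+1$, and (ii) if $x=y$ is a subformula of $\phi$ then $\sigma(y)=\sigma(x)$. A formula is stratified if it has a stratification. $\mathrm{NF}$ is the $\mathcal{L}$-theory with axioms: (Extensionality) $\forall x\forall y(x=y\iff\forall z(z\in x\iff z\in y))$; (Stratified Comprehension) $\forall\vec z\,\exists y\,\forall x(x\in y\iff\varphi(x,\vec z))$ for every stratified $\varphi(x,\vec z)$. *)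

theory Defs
  imports Main
begin

section \<open>The first-order language of set theory\<close>

text \<open>Variables are named and bound variables are kept as named, because a stratification
  assigns a value to every variable of a formula, free or bound.\<close>

type_synonym var = nat

datatype fm =
    Mem var var
  | Eq var var
  | Neg fm
  | Imp fm fm
  | Forall var fm

abbreviation And :: "fm \<Rightarrow> fm \<Rightarrow> fm" where
  "And p q \<equiv> Neg (Imp p (Neg q))"

abbreviation Iff :: "fm \<Rightarrow> fm \<Rightarrow> fm" where
  "Iff p q \<equiv> And (Imp p q) (Imp q p)"

abbreviation Exists :: "var \<Rightarrow> fm \<Rightarrow> fm" where
  "Exists x p \<equiv> Neg (Forall x (Neg p))"

abbreviation Foralls :: "var list \<Rightarrow> fm \<Rightarrow> fm" where
  "Foralls xs p \<equiv> foldr Forall xs p"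

abbreviation Existss :: "var list \<Rightarrow> fm \<Rightarrow> fm" where
  "Existss xs p \<equiv> foldr Exists xs p"

primrec fv :: "fm \<Rightarrow> var set" where
  "fv (Mem x y) = {x, y}"
| "fv (Eq x y) = {x, y}"
| "fv (Neg p) = fv p"
| "fv (Imp p q) = fv p \<union> fv q"
| "fv (Forall x p) = fv p - {x}"

definition sentence :: "fm \<Rightarrow> bool" where
  "sentence p \<longleftrightarrow> fv p = {}"

primrec quantifier_free :: "fm \<Rightarrow> bool" where
  "quantifier_free (Mem x y) \<longleftrightarrow> True"
| "quantifier_free (Eq x y) \<longleftrightarrow> True"
| "quantifier_free (Neg p) \<longleftrightarrow> quantifier_free p"
| "quantifier_free (Imp p q) \<longleftrightarrow> quantifier_free p \<and> quantifier_free q"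
| "quantifier_free (Forall x p) \<longleftrightarrow> False"

primrec subformulas :: "fm \<Rightarrow> fm set" where
  "subformulas (Mem x y) = {Mem x y}"
| "subformulas (Eq x y) = {Eq x y}"
| "subformulas (Neg p) = insert (Neg p) (subformulas p)"
| "subformulas (Imp p q) = insert (Imp p q) (subformulas p \<union> subformulas q)"
| "subformulas (Forall x p) = insert (Forall x p) (subformulas p)"


section \<open>Derivability\<close>

text \<open>\<open>subst p x y\<close> puts \<open>y\<close> for the free occurrences of \<open>x\<close> in \<open>p\<close>, without renaming bound
  variables; \<open>free_for y x p\<close> says that no such occurrence gets captured.\<close>

primrec subst :: "fm \<Rightarrow> var \<Rightarrow> var \<Rightarrow> fm" where
  "subst (Mem a b) x y = Mem (if a = x then y else a) (if b = x then y else b)"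
| "subst (Eq a b) x y = Eq (if a = x then y else a) (if b = x then y else b)"
| "subst (Neg p) x y = Neg (subst p x y)"
| "subst (Imp p q) x y = Imp (subst p x y) (subst q x y)"
| "subst (Forall z p) x y = Forall z (if z = x then p else subst p x y)"

primrec free_for :: "var \<Rightarrow> var \<Rightarrow> fm \<Rightarrow> bool" where
  "free_for y x (Mem a b) \<longleftrightarrow> True"
| "free_for y x (Eq a b) \<longleftrightarrow> True"
| "free_for y x (Neg p) \<longleftrightarrow> free_for y x p"
| "free_for y x (Imp p q) \<longleftrightarrow> free_for y x p \<and> free_for y x q"
| "free_for y x (Forall z p) \<longleftrightarrow> x \<notin> fv (Forall z p) \<or> (z \<noteq> y \<and> free_for y x p)"

text \<open>Natural deduction for classical first-order logic with equality. The only terms of the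
  language are variables.\<close>

inductive derives :: "fm set \<Rightarrow> fm \<Rightarrow> bool" (infix "\<turnstile>" 50) where
  Assm: "p \<in> \<Gamma> \<Longrightarrow> \<Gamma> \<turnstile> p"
| ImpI: "insert p \<Gamma> \<turnstile> q \<Longrightarrow> \<Gamma> \<turnstile> Imp p q"
| ImpE: "\<Gamma> \<turnstile> Imp p q \<Longrightarrow> \<Gamma> \<turnstile> p \<Longrightarrow> \<Gamma> \<turnstile> q"
| Contr: "insert (Neg p) \<Gamma> \<turnstile> q \<Longrightarrow> insert (Neg p) \<Gamma> \<turnstile> Neg q \<Longrightarrow> \<Gamma> \<turnstile> p"
| ForallI: "\<Gamma> \<turnstile> p \<Longrightarrow> (\<And>q. q \<in> \<Gamma> \<Longrightarrow> x \<notin> fv q) \<Longrightarrow> \<Gamma> \<turnstile> Forall x p"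
| ForallE: "\<Gamma> \<turnstile> Forall x p \<Longrightarrow> free_for y x p \<Longrightarrow> \<Gamma> \<turnstile> subst p x y"
| EqRefl: "\<Gamma> \<turnstile> Eq x x"
| EqSubst: "\<Gamma> \<turnstile> Eq x y \<Longrightarrow> \<Gamma> \<turnstile> subst p z x \<Longrightarrow> free_for x z p \<Longrightarrow> free_for y z p
    \<Longrightarrow> \<Gamma> \<turnstile> subst p z y"

definition decides :: "fm set \<Rightarrow> fm \<Rightarrow> bool" where
  "decides T p \<longleftrightarrow> T \<turnstile> p \<or> T \<turnstile> Neg p"


section \<open>Stratification and NF\<close>

text \<open>A stratification is a map on the variables of the formula. It is rendered by a total
  function whose values at other variables are not constrained.\<close>

definition stratification :: "(var \<Rightarrow> nat) \<Rightarrow> fm \<Rightarrow> bool" where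
  "stratification \<sigma> p \<longleftrightarrow>
     (\<forall>x y. Mem x y \<in> subformulas p \<longrightarrow> \<sigma> y = \<sigma> x + 1) \<and>
     (\<forall>x y. Eq x y \<in> subformulas p \<longrightarrow> \<sigma> y = \<sigma> x)"

definition stratified :: "fm \<Rightarrow> bool" where
  "stratified p \<longleftrightarrow> (\<exists>\<sigma>. stratification \<sigma> p)"

definition extensionality :: fm where
  "extensionality =
     Forall 0 (Forall 1 (Iff (Eq 0 1) (Forall 2 (Iff (Mem 2 0) (Mem 2 1)))))"

definition stratified_comprehension :: "fm set" where
  "stratified_comprehension =
     {Foralls zs (Exists y (Forall x (Iff (Mem x y) p))) | zs x y p.
        stratified p \<and> distinct (x # y # zs) \<and> fv p \<subseteq> insert x (set zs)}"

definition NF :: "fm set" where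
  "NF = insert extensionality stratified_comprehension"

end

theory Submission
  imports Defs "HOL-Library.Countable"
begin

text \<open>
  By completeness, an undecided \<open>\<phi>\<close> would be true in one model of NF and false in another. So it
  suffices to show that \<open>\<phi>\<close> has the same truth value in any two models of NF.

  Let all the \<open>y\<close> have level \<open>n\<close>. By stratification, an element \<open>a\<close> that is a candidate for
  some \<open>y\<close> is compared with the values of the \<open>x\<close> in three ways only: which values of level
  \<open>n - 1\<close> belong to \<open>a\<close>, which value of level \<open>n\<close> is equal to \<open>a\<close>, and which values of level
  \<open>n + 1\<close> contain \<open>a\<close>. Call this the profile of \<open>a\<close>; the profiles cut the universe into finitely
  many cells. Whether the existential block can be satisfied depends only on the atomic facts about
  the \<open>x\<close> and on the sizes of the cells, and sizes above the number of the \<open>y\<close> need not be told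
  apart (\<open>answer_witnesses\<close>).

  So it is enough to copy a valuation of the \<open>x\<close> from one model to another, preserving the atomic
  facts and the sizes of the cells up to a given bound (\<open>ex_similar\<close>). The variables are treated in
  increasing order of their level. Prescribing which of finitely many values belong to a new value
  leaves infinitely many choices, since a model of NF is infinite; this serves all levels but
  \<open>n + 1\<close> (\<open>agree_extend\<close>), and as long as only levels up to \<open>n\<close> occur, every cell
  whose profile contains no variable of level \<open>n\<close> is empty or infinite, in both models alike
  (\<open>similar_low\<close>).
  A value \<open>c\<close> of level \<open>n + 1\<close> splits every cell in two. A cell of similar size in the
  other model can be split accordingly into a finite part and the rest (\<open>same_upto_split\<close>),
  and finitely many parts of this kind always add up to a set of the model
  (\<open>similar_set\<close>). Each such split halves the bound, which is harmless because the bound at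
  the outset is arbitrary.

  Of NF this uses extensionality and the comprehension instances for complements, unions, singletons
  and the sets \<open>{y. a \<in> y}\<close>; they are collected in the locale \<open>nf_structure\<close>.
\<close>

section \<open>Substitution and satisfaction\<close>

primrec vars :: "fm \<Rightarrow> var set" where
  "vars (Mem x y) = {x, y}"
| "vars (Eq x y) = {x, y}"
| "vars (Neg p) = vars p"
| "vars (Imp p q) = vars p \<union> vars q"
| "vars (Forall x p) = insert x (vars p)"

instance fm :: countable
  by countable_datatype

lemma finite_vars: "finite (vars p)"
  by (induction p) auto

lemma fv_subset_vars: "fv p \<subseteq> vars p"
  by (induction p) auto

lemma free_for_fresh: "y \<notin> vars p \<Longrightarrow> free_for y x p"
  by (induction p) auto

lemma free_for_same: "free_for x x p"
  by (induction p) auto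

lemma subst_same: "subst p x x = p"
  by (induction p) auto

lemma subst_idle: "x \<notin> fv p \<Longrightarrow> subst p x y = p"
  by (induction p) auto

lemma subst_fresh: "x \<notin> vars p \<Longrightarrow> subst p x y = p"
  using fv_subset_vars subst_idle by blast

text \<open>Renaming a variable to a fresh one and back: the link between a universal formula and
  its instance at a Henkin witness.\<close>
lemma subst_undo: "y \<notin> vars p \<Longrightarrow> subst (subst p x y) y x = p \<and> free_for x y (subst p x y)"
  by (induction p) (use fv_subset_vars in \<open>auto simp: subst_fresh\<close>)

lemma fv_subst: "fv (subst p x y) \<subseteq> (fv p - {x}) \<union> {y}"
  by (induction p) (auto split: if_splits)

lemma size_subst [simp]: "size (subst p x y) = size p"
  by (induction p) auto

primrec sat :: "'a set \<Rightarrow> ('a \<Rightarrow> 'a \<Rightarrow> bool) \<Rightarrow> (var \<Rightarrow> 'a) \<Rightarrow> fm \<Rightarrow> bool" where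
  "sat D E v (Mem x y) \<longleftrightarrow> E (v x) (v y)"
| "sat D E v (Eq x y) \<longleftrightarrow> v x = v y"
| "sat D E v (Neg p) \<longleftrightarrow> \<not> sat D E v p"
| "sat D E v (Imp p q) \<longleftrightarrow> (sat D E v p \<longrightarrow> sat D E v q)"
| "sat D E v (Forall x p) \<longleftrightarrow> (\<forall>a\<in>D. sat D E (v(x := a)) p)"

lemma sat_cong: "(\<And>x. x \<in> fv p \<Longrightarrow> v x = w x) \<Longrightarrow> sat D E v p \<longleftrightarrow> sat D E w p"
proof (induction p arbitrary: v w)
  case (Forall x p)
  have "sat D E (v(x := a)) p \<longleftrightarrow> sat D E (w(x := a)) p" for a
    by (rule Forall.IH) (use Forall.prems in auto)
  then show ?case by simp
next
  case (Imp p q)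
  then show ?case by (metis UnCI fv.simps(4) sat.simps(4))
next
  case (Neg p)
  then show ?case by (metis fv.simps(3) sat.simps(3))
qed simp_all

lemma sat_subst: "free_for y x p \<Longrightarrow> sat D E v (subst p x y) \<longleftrightarrow> sat D E (v(x := v y)) p"
proof (induction p arbitrary: v)
  case (Forall z p)
  consider "z = x" | "z \<noteq> x" "x \<notin> fv p" | "z \<noteq> x" "z \<noteq> y" "free_for y x p"
    using Forall.prems by auto
  then show ?case
  proof cases
    case 1
    show ?thesis
      by (simp only: 1 subst.simps sat.simps simp_thms if_True fun_upd_upd)
  next
    case 2
    have "sat D E (v(z := a)) p \<longleftrightarrow> sat D E (v(x := v y, z := a)) p" for a
      by (rule sat_cong) (use 2 in auto)
    with 2 show ?thesis by (simp add: subst_idle del: fun_upd_apply)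
  next
    case 3
    have "sat D E (v(z := a)) (subst p x y) \<longleftrightarrow> sat D E (v(x := v y, z := a)) p" for a
      using Forall.IH[OF 3(3), of "v(z := a)"] 3 by (metis fun_upd_other fun_upd_twist)
    with 3(1) show ?thesis by (simp only: subst.simps sat.simps if_False)
  qed
qed auto


section \<open>Completeness for theories whose axioms are sentences\<close>

lemma derives_imp_refl: "\<Gamma> \<turnstile> Imp p p"
  by (intro ImpI Assm) simp

lemma derives_neg_neg: "\<Gamma> \<turnstile> Imp (Neg (Neg p)) p"
  by (rule ImpI, rule Contr[of p _ "Neg p"]) (auto intro: Assm)

lemma derives_imp_trans: "\<Gamma> \<turnstile> Imp (Imp p q) (Imp (Imp q r) (Imp p r))"
  by (intro ImpI) (meson Assm ImpE insertI1 insertI2)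

lemma derives_imp_neg: "\<Gamma> \<turnstile> Imp (Imp c q) (Imp (Imp c (Neg q)) (Neg c))"
proof -
  let ?\<Gamma> = "insert (Neg (Neg c)) (insert (Imp c (Neg q)) (insert (Imp c q) \<Gamma>))"
  have "?\<Gamma> \<turnstile> c" by (rule ImpE[OF derives_neg_neg]) (simp add: Assm)
  then have "?\<Gamma> \<turnstile> q" "?\<Gamma> \<turnstile> Neg q"
    by (meson Assm ImpE insertI1 insertI2)+
  then show ?thesis by (intro ImpI) (rule Contr)
qed

lemma derives_imp_dist: "\<Gamma> \<turnstile> Imp (Imp c (Imp p q)) (Imp (Imp c p) (Imp c q))"
  by (intro ImpI) (meson Assm ImpE insertI1 insertI2)

lemma derives_and1: "\<Gamma> \<turnstile> Imp (And p q) p"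
  by (rule ImpI, rule Contr[of p _ "Imp p (Neg q)"])
    (intro ImpI, rule Contr[of _ _ p], auto intro: Assm)

lemma derives_and2: "\<Gamma> \<turnstile> Imp (And p q) q"
  by (rule ImpI, rule Contr[of q _ "Imp p (Neg q)"]) (auto intro: Assm ImpI)

lemma derives_const: "\<Gamma> \<turnstile> Imp p (Imp c p)"
  by (intro ImpI Assm) simp

lemma derives_EqSubst: "free_for x z p \<Longrightarrow> free_for y z p \<Longrightarrow>
    \<Gamma> \<turnstile> Imp (Eq x y) (Imp (subst p z x) (subst p z y))"
  by (intro ImpI EqSubst[of _ x y]) (auto intro: Assm)

text \<open>The eigenvariable condition of \<open>ForallI\<close> concerns the whole context, so that adding hypotheses to
  a derivation would force a renaming of bound variables. This is avoided by keeping all hypotheses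
  in one formula \<open>c\<close> on the left of an implication: the context remains the set \<open>T\<close> of
  sentences, for which the condition always holds.\<close>
locale theory_of_sentences =
  fixes T :: "fm set"
  assumes closed: "p \<in> T \<Longrightarrow> sentence p"
begin

definition entails :: "fm \<Rightarrow> fm \<Rightarrow> bool" (infix "\<tturnstile>" 50) where
  "c \<tturnstile> p \<longleftrightarrow> T \<turnstile> Imp c p"

definition consistent :: "fm \<Rightarrow> bool" where
  "consistent c \<longleftrightarrow> \<not> T \<turnstile> Neg c"

lemma entails_refl: "c \<tturnstile> c"
  by (simp add: entails_def derives_imp_refl)

lemma entails_trans: "c \<tturnstile> p \<Longrightarrow> p \<tturnstile> q \<Longrightarrow> c \<tturnstile> q"
  unfolding entails_def by (meson ImpE derives_imp_trans)

lemma entails_mp: "c \<tturnstile> Imp p q \<Longrightarrow> c \<tturnstile> p \<Longrightarrow> c \<tturnstile> q"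
  unfolding entails_def by (meson ImpE derives_imp_dist)

lemma entails_theorem: "T \<turnstile> p \<Longrightarrow> c \<tturnstile> p"
  unfolding entails_def by (meson ImpE derives_const)

lemma entails_neg_neg: "c \<tturnstile> Neg (Neg p) \<Longrightarrow> c \<tturnstile> p"
  by (meson derives_neg_neg entails_mp entails_theorem)

lemma consistent_no_clash: "consistent c \<Longrightarrow> c \<tturnstile> p \<Longrightarrow> \<not> c \<tturnstile> Neg p"
  unfolding entails_def consistent_def by (meson ImpE derives_imp_neg)

lemma inconsistent_And: "\<not> consistent (And c p) \<Longrightarrow> c \<tturnstile> Neg p"
  unfolding entails_def consistent_def by (meson ImpE derives_neg_neg)

lemma consistent_And_cases:
  "consistent c \<Longrightarrow> consistent (And c p) \<or> consistent (And c (Neg p))"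
  using inconsistent_And consistent_no_clash entails_neg_neg by blast

lemma derives_Forall: "T \<turnstile> p \<Longrightarrow> T \<turnstile> Forall x p"
  using closed by (auto intro!: ForallI simp: sentence_def)

lemma entails_Forall:
  assumes "c \<tturnstile> p" "x \<notin> fv c"
  shows "c \<tturnstile> Forall x p"
proof -
  let ?\<Gamma> = "insert c (insert (Forall x (Imp c p)) T)"
  have "T \<turnstile> Forall x (Imp c p)"
    using assms(1) derives_Forall by (simp add: entails_def)
  moreover have "T \<turnstile> Imp (Forall x (Imp c p)) (Imp c (Forall x p))"
  proof (intro ImpI ForallI)
    have "?\<Gamma> \<turnstile> subst (Imp c p) x x"
      by (rule ForallE) (auto intro: Assm simp: free_for_same)
    then show "?\<Gamma> \<turnstile> p"
      unfolding subst_same by (rule ImpE) (simp add: Assm)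
  next
    show "x \<notin> fv q" if "q \<in> ?\<Gamma>" for q
      using that assms(2) closed by (auto simp: sentence_def)
  qed
  ultimately show ?thesis unfolding entails_def by (rule ImpE[rotated])
qed

lemma entails_instance: "free_for y x p \<Longrightarrow> Forall x p \<tturnstile> subst p x y"
  unfolding entails_def by (intro ImpI ForallE Assm) auto

text \<open>If \<open>c\<close> refuted the new hypothesis it would imply the instance of \<open>p\<close> at the fresh \<open>y\<close>. One can
  then generalise over \<open>y\<close>, and pass back to \<open>x\<close> by \<open>subst_undo\<close>; the detour makes \<open>x\<close> harmless even
  if it is free in \<open>c\<close>.\<close>
lemma consistent_witness:
  assumes "consistent c" "c \<tturnstile> Neg (Forall x p)" "y \<notin> vars c" "y \<notin> vars p"
  shows "consistent (And c (Neg (subst p x y)))"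
proof (rule ccontr)
  assume "\<not> ?thesis"
  then have "c \<tturnstile> subst p x y"
    using inconsistent_And entails_neg_neg by blast
  then have "c \<tturnstile> Forall y (subst p x y)"
    using assms(3) fv_subset_vars entails_Forall by blast
  moreover have "Forall y (subst p x y) \<tturnstile> Forall x p"
  proof (rule entails_Forall)
    show "Forall y (subst p x y) \<tturnstile> p"
      using subst_undo[OF assms(4), of x] entails_instance[of x y "subst p x y"] by simp
    show "x \<notin> fv (Forall y (subst p x y))"
      using fv_subst[of p x y] by auto
  qed
  ultimately show False
    using assms(1,2) consistent_no_clash entails_trans by blast
qed

text \<open>The lower bound \<open>m\<close> on the witness provides, in the end, arbitrarily large variables that are
  equal to a given one.\<close>
lemma henkin_step:
  assumes "consistent c"
  shows "\<exists>c'. consistent c' \<and> c' \<tturnstile> c \<and> (c' \<tturnstile> p \<or> c' \<tturnstile> Neg p) \<and>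
    (\<forall>x q. p = Forall x q \<longrightarrow> c' \<tturnstile> p \<or> (\<exists>y\<ge>m. y \<notin> vars q \<and> c' \<tturnstile> Neg (subst q x y)))"
proof (cases "consistent (And c p)")
  case True
  then show ?thesis
    by (intro exI[of _ "And c p"]) (auto simp: entails_def derives_and1 derives_and2)
next
  case False
  let ?c = "And c (Neg p)"
  have con: "consistent ?c" using assms False consistent_And_cases by blast
  have ent: "?c \<tturnstile> c" "?c \<tturnstile> Neg p" by (auto simp: entails_def derives_and1 derives_and2)
  show ?thesis
  proof (cases "\<exists>x q. p = Forall x q")
    case False
    with con ent show ?thesis by blast
  next
    case True
    then obtain x q where Forall: "p = Forall x q" by blast
    have "finite (vars ?c \<union> vars q \<union> {..<m})" by (simp add: finite_vars)
    then obtain y where y: "y \<notin> vars ?c \<union> vars q \<union> {..<m}"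
      using ex_new_if_finite[OF infinite_UNIV_nat] by metis
    let ?d = "And ?c (Neg (subst q x y))"
    have "consistent ?d"
      using consistent_witness[OF con, of x q y] ent y Forall by auto
    moreover have d: "?d \<tturnstile> ?c" and "?d \<tturnstile> Neg (subst q x y)"
      unfolding entails_def by (rule derives_and1, rule derives_and2)
    moreover have "?d \<tturnstile> c" by (rule entails_trans[OF d ent(1)])
    moreover have "?d \<tturnstile> Neg p" by (rule entails_trans[OF d ent(2)])
    moreover have "y \<ge> m" "y \<notin> vars q" using y by auto
    ultimately show ?thesis using Forall by (intro exI[of _ ?d]) auto
  qed
qed

lemma henkin_chain:
  assumes "consistent c0"
  obtains c :: "nat \<Rightarrow> fm" where "c 0 = c0" "\<And>n. consistent (c n)" "\<And>n. c (Suc n) \<tturnstile> c n"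
    "\<And>p. \<exists>n. c n \<tturnstile> p \<or> c n \<tturnstile> Neg p"
    "\<And>x q m. \<exists>n. c n \<tturnstile> Forall x q \<or> (\<exists>y\<ge>m. y \<notin> vars q \<and> c n \<tturnstile> Neg (subst q x y))"
proof -
  \<comment> \<open>Every formula is handled at arbitrarily late stages, so that the stage number can serve as the
    lower bound for the witness.\<close>
  define f :: "nat \<Rightarrow> fm" where "f n = from_nat (fst (prod_decode n))" for n
  have f: "\<exists>n\<ge>m. f n = p" for p m
    by (intro exI[of _ "prod_encode (to_nat p, m)"]) (simp add: f_def le_prod_encode_2)
  define R where "R n c c' \<longleftrightarrow> c' \<tturnstile> c \<and> (c' \<tturnstile> f n \<or> c' \<tturnstile> Neg (f n)) \<and>
    (\<forall>x q. f n = Forall x q \<longrightarrow>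
      c' \<tturnstile> f n \<or> (\<exists>y\<ge>n. y \<notin> vars q \<and> c' \<tturnstile> Neg (subst q x y)))" for n c c'
  have "\<exists>c. c 0 = c0 \<and> (\<forall>n. consistent (c n) \<and> R n (c n) (c (Suc n)))"
  proof -
    have "\<exists>c. \<forall>n. (consistent (c n) \<and> (n = 0 \<longrightarrow> c n = c0)) \<and> R n (c n) (c (Suc n))"
    proof (rule dependent_nat_choice)
      show "\<exists>c. consistent c \<and> (0 = 0 \<longrightarrow> c = c0)" using assms by blast
      show "\<exists>c'. (consistent c' \<and> (Suc n = 0 \<longrightarrow> c' = c0)) \<and> R n c c'"
        if "consistent c \<and> (n = 0 \<longrightarrow> c = c0)" for c n
        using henkin_step[of c "f n" n] that unfolding R_def by simp
    qed
    then show ?thesis by blast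
  qed
  then obtain c where c: "c 0 = c0" "\<And>n. consistent (c n)" "\<And>n. R n (c n) (c (Suc n))"
    by blast
  show thesis
  proof
    show "c 0 = c0" "consistent (c n)" "c (Suc n) \<tturnstile> c n" for n
      using c by (auto simp: R_def)
    show "\<exists>n. c n \<tturnstile> p \<or> c n \<tturnstile> Neg p" for p
    proof -
      obtain n where "f n = p" using f by blast
      with c(3)[of n] show ?thesis unfolding R_def by blast
    qed
    show "\<exists>n. c n \<tturnstile> Forall x q \<or> (\<exists>y\<ge>m. y \<notin> vars q \<and> c n \<tturnstile> Neg (subst q x y))" for x q m
    proof -
      obtain n where "n \<ge> m" "f n = Forall x q" using f by blast
      with c(3)[of n] show ?thesis
        unfolding R_def by (intro exI[of _ "Suc n"]) (metis le_trans)
    qed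
  qed
qed

text \<open>The term model of a Henkin theory: variables modulo provable equality, each class being represented
  by its least element. A quantified formula can be instantiated directly only at variables that do
  not get captured. Every class contains variables outside any given finite set (\<open>another\<close> below), so
  such instances suffice, and no renaming of bound variables is ever needed.\<close>
lemma completeness:
  assumes "consistent c0"
  shows "\<exists>(E :: nat \<Rightarrow> nat \<Rightarrow> bool) v. (\<forall>p\<in>T. sat (range v) E v p) \<and> sat (range v) E v c0"
proof -
  obtain c where c0: "c 0 = c0" and con: "\<And>n. consistent (c n)" and Suc: "\<And>n. c (Suc n) \<tturnstile> c n"
    and total: "\<And>p. \<exists>n. c n \<tturnstile> p \<or> c n \<tturnstile> Neg p"
    and wit: "\<And>x q m. \<exists>n. c n \<tturnstile> Forall x q \<or>
      (\<exists>y\<ge>m. y \<notin> vars q \<and> c n \<tturnstile> Neg (subst q x y))"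
    using henkin_chain[OF assms] by metis
  define H where "H = {p. \<exists>n. c n \<tturnstile> p}"
  have mono: "c n \<tturnstile> p \<Longrightarrow> n \<le> m \<Longrightarrow> c m \<tturnstile> p" for n m p
  proof (induction m)
    case (Suc m)
    then show ?case using \<open>c (Suc m) \<tturnstile> c m\<close> entails_trans le_Suc_eq by blast
  qed simp
  have mp: "q \<in> H" if "Imp p q \<in> H" "p \<in> H" for p q
  proof -
    from that obtain n m where "c n \<tturnstile> Imp p q" "c m \<tturnstile> p" by (auto simp: H_def)
    then have "c (max n m) \<tturnstile> q" using mono entails_mp by (meson max.cobounded1 max.cobounded2)
    then show ?thesis by (auto simp: H_def)
  qed
  have provable: "T \<turnstile> p \<Longrightarrow> p \<in> H" for p
    using entails_theorem by (auto simp: H_def)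
  have neg: "Neg p \<in> H \<longleftrightarrow> p \<notin> H" for p
  proof
    assume "Neg p \<in> H"
    then obtain n where n: "c n \<tturnstile> Neg p" by (auto simp: H_def)
    show "p \<notin> H"
    proof
      assume "p \<in> H"
      then obtain m where "c m \<tturnstile> p" by (auto simp: H_def)
      with n con[of "max n m"] show False
        using mono consistent_no_clash by (meson max.cobounded1 max.cobounded2)
    qed
  next
    assume "p \<notin> H"
    then show "Neg p \<in> H" using total[of p] by (auto simp: H_def)
  qed
  have imp: "Imp p q \<in> H \<longleftrightarrow> (p \<in> H \<longrightarrow> q \<in> H)" for p q
  proof
    assume "p \<in> H \<longrightarrow> q \<in> H"
    then consider "q \<in> H" | "Neg p \<in> H" using neg by blast
    then show "Imp p q \<in> H"
    proof cases
      case 1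
      then show ?thesis using mp provable[OF derives_const] by blast
    next
      case 2
      have "T \<turnstile> Imp (Neg p) (Imp p q)"
        by (intro ImpI, rule Contr[of _ _ p]) (auto intro: Assm)
      then show ?thesis using 2 mp provable by blast
    qed
  next
    assume "Imp p q \<in> H"
    then show "p \<in> H \<longrightarrow> q \<in> H" by (intro impI) (rule mp)
  qed
  have eq_subst: "Eq x y \<in> H \<Longrightarrow> subst p z x \<in> H \<Longrightarrow> free_for x z p \<Longrightarrow> free_for y z p \<Longrightarrow>
      subst p z y \<in> H" for x y z p
    using provable[OF derives_EqSubst, of x z p y] by (simp add: imp)
  have other: "\<exists>z. z \<noteq> x" for x :: var
    by (rule exI[of _ "Suc x"]) simp
  have refl: "Eq x x \<in> H" for x by (rule provable[OF EqRefl])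
  have sym: "Eq y x \<in> H" if "Eq x y \<in> H" for x y
  proof -
    obtain z where "z \<noteq> x" using other by blast
    then show ?thesis using eq_subst[OF that, of "Eq z x" z] refl[of x] by simp
  qed
  have trans: "Eq x z \<in> H" if "Eq x y \<in> H" "Eq y z \<in> H" for x y z
  proof -
    obtain u where "u \<noteq> x" using other by blast
    then show ?thesis using eq_subst[OF that(2), of "Eq x u" u] that(1) by simp
  qed
  have mem: "Mem x' y' \<in> H" if "Mem x y \<in> H" "Eq x x' \<in> H" "Eq y y' \<in> H" for x y x' y'
  proof -
    obtain z where "z \<noteq> y" using other by blast
    then have "Mem x' y \<in> H" using eq_subst[OF that(2), of "Mem z y" z] that(1) by simp
    moreover obtain u where "u \<noteq> x'" using other by blast
    ultimately show ?thesis using eq_subst[OF that(3), of "Mem x' u" u] by simp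
  qed
  define v where "v x = (LEAST y. Eq x y \<in> H)" for x
  define E where "E x y \<longleftrightarrow> Mem x y \<in> H" for x y
  have v: "Eq x (v x) \<in> H" for x unfolding v_def by (rule LeastI) (rule refl)
  have v_eq: "v x = v y \<longleftrightarrow> Eq x y \<in> H" for x y
  proof
    assume "v x = v y"
    then show "Eq x y \<in> H" using v sym trans by metis
  next
    assume "Eq x y \<in> H"
    then have "Eq x z \<in> H \<longleftrightarrow> Eq y z \<in> H" for z using sym trans by blast
    then show "v x = v y" by (simp add: v_def)
  qed
  have E: "E (v x) (v y) \<longleftrightarrow> Mem x y \<in> H" for x y
    unfolding E_def using mem v sym by blast
  have another: "\<exists>z. v z = v y \<and> z \<notin> W" if W: "finite W" for y W
  proof -
    \<comment> \<open>The theory refutes that no \<open>x\<close> equals \<open>y\<close>, and its witnesses against this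
      can be chosen as large as desired.\<close>
    obtain x where "x \<noteq> y" using other by blast
    let ?q = "Neg (Eq x y)"
    from W obtain m where m: "\<forall>w\<in>W. w < m"
      using finite_nat_set_iff_bounded by auto
    have "Forall x ?q \<notin> H"
    proof
      assume "Forall x ?q \<in> H"
      moreover have "T \<turnstile> Imp (Forall x ?q) (subst ?q x y)"
        using entails_instance[of y x ?q] by (simp add: entails_def)
      ultimately have "Neg (Eq y y) \<in> H"
        using mp provable \<open>x \<noteq> y\<close> by fastforce
      then show False using neg refl by blast
    qed
    with wit[of x ?q m] obtain n z where "z \<ge> m" "c n \<tturnstile> Neg (subst ?q x z)"
      by (auto simp: H_def)
    then have "Eq z y \<in> H" "z \<notin> W"
      using \<open>x \<noteq> y\<close> m entails_neg_neg by (auto simp: H_def)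
    then show ?thesis using v_eq by blast
  qed
  have truth: "sat (range v) E v p \<longleftrightarrow> p \<in> H" for p
  proof (induction p rule: measure_induct_rule[of size])
    case (less p)
    show ?case
    proof (cases p)
      case (Forall x q)
      have IH: "sat (range v) E (v(x := v y)) q \<longleftrightarrow> subst q x y \<in> H" if "y \<notin> vars q" for y
      proof -
        have "sat (range v) E (v(x := v y)) q \<longleftrightarrow> sat (range v) E v (subst q x y)"
          by (rule sat_subst[OF free_for_fresh[OF that], symmetric])
        also have "\<dots> \<longleftrightarrow> subst q x y \<in> H"
          by (rule less) (simp add: Forall)
        finally show ?thesis .
      qed
      show ?thesis
      proof
        assume p: "p \<in> H"
        have "sat (range v) E (v(x := v y)) q" for y
        proof -
          obtain z where z: "v z = v y" "z \<notin> vars q" using another finite_vars by metis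
          have "Imp (Forall x q) (subst q x z) \<in> H"
            using provable entails_instance[OF free_for_fresh[OF z(2)]] by (simp add: entails_def)
          then show ?thesis using IH[OF z(2)] p Forall z(1) mp by metis
        qed
        then show "sat (range v) E v p" using Forall by auto
      next
        assume sat: "sat (range v) E v p"
        show "p \<in> H"
        proof (rule ccontr)
          assume "p \<notin> H"
          with wit[of x q 0] Forall obtain y where "y \<notin> vars q" "Neg (subst q x y) \<in> H"
            by (auto simp: H_def)
          with IH sat Forall show False using neg by auto
        qed
      qed
    qed (use less in \<open>auto simp: neg imp v_eq E\<close>)
  qed
  have "c0 \<in> H" using c0 entails_refl[of c0] unfolding H_def by (metis mem_Collect_eq)
  moreover have "p \<in> H" if "p \<in> T" for p using provable Assm that by blast
  ultimately show ?thesis using truth by blast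
qed

end

section \<open>Structures with the set operations that NF provides\<close>

definition extent :: "'a set \<Rightarrow> ('a \<Rightarrow> 'a \<Rightarrow> bool) \<Rightarrow> 'a \<Rightarrow> 'a set" where
  "extent D E a = {z \<in> D. E z a}"

definition internal :: "'a set \<Rightarrow> ('a \<Rightarrow> 'a \<Rightarrow> bool) \<Rightarrow> 'a set \<Rightarrow> bool" where
  "internal D E X \<longleftrightarrow> (\<exists>a\<in>D. extent D E a = X)"

text \<open>All that a stratified atomic formula can say about an element \<open>a\<close> of level \<open>n\<close> and the values
  of the variables in \<open>V\<close>. One set of variables records the three kinds of atoms without ambiguity,
  because the level of a variable determines the kind.\<close>
definition profile ::
    "('a \<Rightarrow> 'a \<Rightarrow> bool) \<Rightarrow> (var \<Rightarrow> nat) \<Rightarrow> nat \<Rightarrow> var set \<Rightarrow> (var \<Rightarrow> 'a) \<Rightarrow> 'a \<Rightarrow> var set" where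
  "profile E \<sigma> n V v a = {u \<in> V. Suc (\<sigma> u) = n \<and> E (v u) a \<or> \<sigma> u = n \<and> v u = a \<or>
     \<sigma> u = Suc n \<and> E a (v u)}"

definition cell :: "'a set \<Rightarrow> ('a \<Rightarrow> 'a \<Rightarrow> bool) \<Rightarrow> (var \<Rightarrow> nat) \<Rightarrow> nat \<Rightarrow> var set \<Rightarrow>
    (var \<Rightarrow> 'a) \<Rightarrow> var set \<Rightarrow> 'a set" where
  "cell D E \<sigma> n V v P = {a \<in> D. profile E \<sigma> n V v a = P}"

locale nf_structure =
  fixes D :: "'a set" and E :: "'a \<Rightarrow> 'a \<Rightarrow> bool"
  assumes nonempty: "D \<noteq> {}"
    and extensional: "a \<in> D \<Longrightarrow> b \<in> D \<Longrightarrow> extent D E a = extent D E b \<Longrightarrow> a = b"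
    and internal_Compl: "internal D E X \<Longrightarrow> internal D E (D - X)"
    and internal_Un: "internal D E X \<Longrightarrow> internal D E Y \<Longrightarrow> internal D E (X \<union> Y)"
    and internal_singleton: "a \<in> D \<Longrightarrow> internal D E {a}"
    and internal_containing: "a \<in> D \<Longrightarrow> internal D E {y \<in> D. E a y}"
begin

lemma internal_subset: "internal D E X \<Longrightarrow> X \<subseteq> D"
  by (auto simp: internal_def extent_def)

lemma internal_extent: "a \<in> D \<Longrightarrow> internal D E (extent D E a)"
  by (auto simp: internal_def)

lemma internal_full: "internal D E D"
proof -
  obtain a where "a \<in> D" using nonempty by blast
  then have "internal D E ({a} \<union> (D - {a}))"
    by (intro internal_Un internal_Compl internal_singleton)
  with \<open>a \<in> D\<close> show ?thesis by (simp add: insert_absorb)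
qed

lemma internal_empty: "internal D E {}"
  using internal_Compl[OF internal_full] by simp

lemma internal_Int:
  assumes "internal D E X" "internal D E Y"
  shows "internal D E (X \<inter> Y)"
proof -
  have "internal D E (D - ((D - X) \<union> (D - Y)))"
    by (intro internal_Compl internal_Un assms)
  moreover have "D - ((D - X) \<union> (D - Y)) = X \<inter> Y"
    using assms internal_subset by blast
  ultimately show ?thesis by simp
qed

lemma internal_UN: "finite I \<Longrightarrow> (\<And>i. i \<in> I \<Longrightarrow> internal D E (B i)) \<Longrightarrow> internal D E (\<Union>i\<in>I. B i)"
  by (induction I rule: finite_induct) (auto intro: internal_empty internal_Un)

lemma internal_finite:
  assumes "finite F" "F \<subseteq> D"
  shows "internal D E F"
  using internal_UN[OF assms(1), of "\<lambda>a. {a}"] assms(2) internal_singleton by auto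

text \<open>Cantor's argument: if the universe were finite, each of its subsets would be internal, but there
  are fewer elements than subsets.\<close>
lemma infinite_carrier: "infinite D"
proof
  assume fin: "finite D"
  then have "Pow D \<subseteq> extent D E ` D"
    using internal_finite finite_subset unfolding internal_def by blast
  then have "card (Pow D) \<le> card D"
    using fin by (meson card_image_le card_mono finite_imageI le_trans)
  with fin show False using less_exp[of "card D"] by (simp add: card_Pow)
qed

text \<open>The sets \<open>insert e T\<close>, with \<open>e\<close> outside \<open>F\<close>, are infinitely many examples.\<close>
lemma infinite_trace:
  assumes "finite F" "F \<subseteq> D" "T \<subseteq> F"
  shows "infinite {d \<in> D. extent D E d \<inter> F = T}"
proof
  assume fin: "finite {d \<in> D. extent D E d \<inter> F = T}"
  have "\<exists>d\<in>D. extent D E d = insert e T" if "e \<in> D - F" for e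
    using internal_finite[of "insert e T"] that assms finite_subset unfolding internal_def by blast
  then obtain g where g: "\<And>e. e \<in> D - F \<Longrightarrow> g e \<in> D \<and> extent D E (g e) = insert e T"
    by metis
  have "inj_on g (D - F)"
  proof (rule inj_onI)
    fix e e' assume "e \<in> D - F" "e' \<in> D - F" "g e = g e'"
    moreover from this have "insert e T = insert e' T" using g by metis
    ultimately show "e = e'" using assms(3) by auto
  qed
  moreover have "g ` (D - F) \<subseteq> {d \<in> D. extent D E d \<inter> F = T}"
    using g assms(3) by auto
  ultimately have "finite (D - F)" using fin inj_on_finite by blast
  with infinite_carrier assms(1) show False by simp
qed

lemma internal_boolean_cell:
  assumes "finite V" "\<And>u. u \<in> V \<Longrightarrow> internal D E (S u)"
  shows "internal D E {a \<in> D. \<forall>u\<in>V. a \<in> S u \<longleftrightarrow> u \<in> P}"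
  using assms
proof (induction V rule: finite_induct)
  case empty
  then show ?case using internal_full by simp
next
  case (insert u V)
  let ?C = "{a \<in> D. \<forall>u\<in>V. a \<in> S u \<longleftrightarrow> u \<in> P}"
  have "{a \<in> D. \<forall>u\<in>insert u V. a \<in> S u \<longleftrightarrow> u \<in> P} = (if u \<in> P then S u else D - S u) \<inter> ?C"
    using internal_subset[OF insert.prems[of u]] by auto
  moreover have "internal D E (if u \<in> P then S u else D - S u)" "internal D E ?C"
    using insert internal_Compl by auto
  ultimately show ?case using internal_Int by simp
qed

lemma internal_cell:
  assumes "finite V" "range v \<subseteq> D"
  shows "internal D E (cell D E \<sigma> n V v P)"
proof (cases "P \<subseteq> V")
  case True
  define S where "S u = {a \<in> D. Suc (\<sigma> u) = n \<and> E (v u) a \<or> \<sigma> u = n \<and> v u = a \<or>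
     \<sigma> u = Suc n \<and> E a (v u)}" for u
  have S: "internal D E (S u)" for u
  proof -
    have "v u \<in> D" using assms(2) by blast
    consider "Suc (\<sigma> u) = n" | "\<sigma> u = n" | "\<sigma> u = Suc n"
      | "Suc (\<sigma> u) \<noteq> n \<and> \<sigma> u \<noteq> n \<and> \<sigma> u \<noteq> Suc n" by blast
    then show ?thesis
    proof cases
      case 1
      then have "S u = {a \<in> D. E (v u) a}" by (auto simp: S_def)
      with \<open>v u \<in> D\<close> show ?thesis using internal_containing by simp
    next
      case 2
      with \<open>v u \<in> D\<close> have "S u = {v u}" by (auto simp: S_def)
      with \<open>v u \<in> D\<close> show ?thesis using internal_singleton by simp
    next
      case 3
      then have "S u = extent D E (v u)" by (auto simp: S_def extent_def)
      with \<open>v u \<in> D\<close> show ?thesis using internal_extent by simp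
    next
      case 4
      then have "S u = {}" by (auto simp: S_def)
      then show ?thesis using internal_empty by simp
    qed
  qed
  have "profile E \<sigma> n V v a = {u \<in> V. a \<in> S u}" if "a \<in> D" for a
    using that by (simp add: profile_def S_def)
  moreover have "{u \<in> V. a \<in> S u} = P \<longleftrightarrow> (\<forall>u\<in>V. a \<in> S u \<longleftrightarrow> u \<in> P)" for a
    using True by blast
  ultimately have "cell D E \<sigma> n V v P = {a \<in> D. \<forall>u\<in>V. a \<in> S u \<longleftrightarrow> u \<in> P}"
    by (auto simp: cell_def)
  then show ?thesis using internal_boolean_cell[OF assms(1) S] by simp
next
  case False
  then have "cell D E \<sigma> n V v P = {}" by (auto simp: cell_def profile_def)
  then show ?thesis using internal_empty by simp
qed

lemma cell_at_value:
  assumes "u \<in> V" "\<sigma> u = n" "u \<in> P" "v u \<in> D"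
  shows "cell D E \<sigma> n V v P = (if profile E \<sigma> n V v (v u) = P then {v u} else {})"
proof -
  have "v u = a" if "profile E \<sigma> n V v a = P" for a
    using that assms(2,3) by (auto simp: profile_def)
  then have "cell D E \<sigma> n V v P \<subseteq> {v u}" by (auto simp: cell_def)
  with assms(4) show ?thesis by (auto simp: cell_def)
qed

text \<open>Without values above level \<open>n\<close>, and apart from finitely many values at level \<open>n\<close>, a cell
  consists of all elements with a prescribed trace on finitely many values. The condition on values
  says that the prescription is coherent when several variables share their value.\<close>
lemma low_cell:
  assumes "finite V" "range v \<subseteq> D" "\<forall>u\<in>V. \<sigma> u \<le> n" "\<forall>u\<in>V. \<sigma> u = n \<longrightarrow> u \<notin> P"
  defines "L \<equiv> {u \<in> V. Suc (\<sigma> u) = n}"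
  shows "if P \<subseteq> L \<and> (\<forall>u\<in>P. \<forall>u'\<in>L. v u = v u' \<longrightarrow> u' \<in> P)
    then infinite (cell D E \<sigma> n V v P) else cell D E \<sigma> n V v P = {}"
proof (cases "P \<subseteq> L \<and> (\<forall>u\<in>P. \<forall>u'\<in>L. v u = v u' \<longrightarrow> u' \<in> P)")
  case True
  let ?I = "{d \<in> D. extent D E d \<inter> v ` L = v ` P}"
  have "finite L" using assms by (auto simp: L_def)
  then have "infinite ?I"
    using True assms(2) by (intro infinite_trace) auto
  then have "infinite (?I - v ` V)" using assms(1) by simp
  moreover have "?I - v ` V \<subseteq> cell D E \<sigma> n V v P"
  proof
    fix d assume d: "d \<in> ?I - v ` V"
    have E: "E (v u) d \<longleftrightarrow> u \<in> P" if "u \<in> L" for u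
    proof -
      have "E (v u) d \<longleftrightarrow> v u \<in> extent D E d \<inter> v ` L"
        using that assms(2) by (auto simp: extent_def)
      also have "\<dots> \<longleftrightarrow> v u \<in> v ` P" using d by auto
      also have "\<dots> \<longleftrightarrow> u \<in> P" using True that by auto
      finally show ?thesis .
    qed
    have "profile E \<sigma> n V v d = P"
    proof (intro set_eqI iffI)
      fix u assume u: "u \<in> profile E \<sigma> n V v d"
      then have "u \<in> V" "v u \<noteq> d" "\<sigma> u \<noteq> Suc n"
        using d assms(3) by (auto simp: profile_def)
      with u have "u \<in> L" "E (v u) d" by (auto simp: profile_def L_def)
      with E show "u \<in> P" by blast
    next
      fix u assume "u \<in> P"
      with True E show "u \<in> profile E \<sigma> n V v d"
        by (auto simp: profile_def L_def)
    qed
    with d show "d \<in> cell D E \<sigma> n V v P" by (simp add: cell_def)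
  qed
  ultimately show ?thesis using True infinite_super by auto
next
  case False
  have "False" if "a \<in> cell D E \<sigma> n V v P" for a
  proof -
    have P: "u \<in> P \<longleftrightarrow> u \<in> V \<and> (Suc (\<sigma> u) = n \<and> E (v u) a \<or> \<sigma> u = n \<and> v u = a \<or>
        \<sigma> u = Suc n \<and> E a (v u))" for u
      using that by (auto simp: cell_def profile_def)
    have L: "u \<in> L \<and> E (v u) a" if "u \<in> P" for u
    proof -
      have "u \<in> V" "\<sigma> u \<noteq> n" "\<sigma> u \<noteq> Suc n" using that P[of u] assms(3,4) by auto
      then show ?thesis using that P[of u] by (simp add: L_def)
    qed
    have "u' \<in> P" if "u \<in> P" "u' \<in> L" "v u = v u'" for u u'
      using L[OF that(1)] that(2,3) P[of u'] by (simp add: L_def)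
    with L have "P \<subseteq> L \<and> (\<forall>u\<in>P. \<forall>u'\<in>L. v u = v u' \<longrightarrow> u' \<in> P)" by blast
    with False show False by blast
  qed
  with False show ?thesis by auto
qed

lemma cell_insert_set:
  assumes "z \<notin> V" "\<sigma> z = Suc n"
  shows "cell D E \<sigma> n (insert z V) v P =
    (if z \<in> P then cell D E \<sigma> n V v (P - {z}) \<inter> extent D E (v z)
     else cell D E \<sigma> n V v P - extent D E (v z))"
proof -
  have "profile E \<sigma> n (insert z V) v a =
      (if E a (v z) then insert z (profile E \<sigma> n V v a) else profile E \<sigma> n V v a)" for a
    using assms(2) by (auto simp: profile_def)
  moreover have "z \<notin> profile E \<sigma> n V v a" for a using assms(1) by (simp add: profile_def)
  ultimately show ?thesis
    by (auto simp: cell_def extent_def)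
qed

lemma cell_insert_above:
  assumes "\<sigma> z > Suc n"
  shows "cell D E \<sigma> n (insert z V) v P = cell D E \<sigma> n V v P"
proof -
  have "profile E \<sigma> n (insert z V) v a = profile E \<sigma> n V v a" for a
    using assms by (auto simp: profile_def)
  then show ?thesis by (simp add: cell_def)
qed

text \<open>Extensionality in terms of cells: since each cell lies within the value of \<open>u\<close> or is disjoint from
  it, equality with that value can be read off from the emptiness of the parts that \<open>c\<close> cuts out.\<close>
lemma eq_iff_cells:
  assumes "u \<in> V" "\<sigma> u = Suc n" "v u \<in> D" "c \<in> D"
  shows "v u = c \<longleftrightarrow> (\<forall>P. (u \<in> P \<longrightarrow> cell D E \<sigma> n V v P - extent D E c = {}) \<and>
    (u \<notin> P \<longrightarrow> cell D E \<sigma> n V v P \<inter> extent D E c = {}))"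
    (is "_ \<longleftrightarrow> ?R")
proof -
  have u: "u \<in> profile E \<sigma> n V v a \<longleftrightarrow> E a (v u)" for a
    using assms(1,2) by (auto simp: profile_def)
  have "v u = c \<longleftrightarrow> extent D E (v u) = extent D E c"
    using assms(3,4) extensional by auto
  also have "\<dots> \<longleftrightarrow> (\<forall>a\<in>D. u \<in> profile E \<sigma> n V v a \<longleftrightarrow> a \<in> extent D E c)"
    unfolding u by (auto simp: extent_def)
  also have "\<dots> \<longleftrightarrow> ?R" by (auto simp: cell_def)
  finally show ?thesis .
qed

end

lemma cell_cong:
  assumes "\<And>u. u \<in> V \<Longrightarrow> v u = w u"
  shows "cell D E \<sigma> n V v P = cell D E \<sigma> n V w P"
proof -
  have "profile E \<sigma> n V v a = profile E \<sigma> n V w a" for a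
    using assms by (auto simp: profile_def)
  then show ?thesis by (simp add: cell_def)
qed

section \<open>Cardinalities compared up to a bound\<close>

definition same_upto :: "nat \<Rightarrow> 'a set \<Rightarrow> 'b set \<Rightarrow> bool" where
  "same_upto t X Y \<longleftrightarrow> finite X \<and> finite Y \<and> card X = card Y \<or>
     (infinite X \<or> t \<le> card X) \<and> (infinite Y \<or> t \<le> card Y)"

lemma same_upto_empty_iff: "same_upto t X Y \<Longrightarrow> t > 0 \<Longrightarrow> X = {} \<longleftrightarrow> Y = {}"
  by (auto simp: same_upto_def)

lemma large_subset:
  assumes "infinite X \<or> t \<le> card X"
  obtains F where "F \<subseteq> X" "finite F" "card F = t"
proof (cases "finite X")
  case True
  with assms obtain_subset_with_card_n[of t X] that show thesis by metis
next
  case False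
  with infinite_arbitrarily_large[of X t] that show thesis by metis
qed

lemma large_Diff:
  assumes "infinite X \<or> s + t \<le> card X" "F \<subseteq> X" "finite F" "card F \<le> s"
  shows "infinite (X - F) \<or> t \<le> card (X - F)"
  using assms by (auto simp: card_Diff_subset)

text \<open>If \<open>X\<close> and \<open>Y\<close> are too big to be compared exactly, at least one of \<open>A\<close> and \<open>X - A\<close> has at least \<open>t\<close>
  elements. The subset \<open>B\<close> is chosen such that the smaller part is matched exactly, or by \<open>t\<close> elements
  if both parts are large; what remains of \<open>Y\<close> is large as well. Having \<open>B\<close> finite or cofinite makes
  it available in a structure where only such subsets of \<open>Y\<close> need to exist.\<close>
lemma same_upto_split:
  assumes XY: "same_upto (2 * t) X Y" and "A \<subseteq> X"
  shows "\<exists>B\<subseteq>Y. (finite B \<or> finite (Y - B)) \<and> same_upto t A B \<and> same_upto t (X - A) (Y - B)"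
proof -
  consider (eq) "finite X" "finite Y" "card X = card Y"
    | (large) "infinite X \<or> t + t \<le> card X" "infinite Y \<or> t + t \<le> card Y"
    using XY by (auto simp: same_upto_def)
  then show ?thesis
  proof cases
    case eq
    have "card A \<le> card Y" using eq \<open>A \<subseteq> X\<close> card_mono by metis
    then obtain B where B: "B \<subseteq> Y" "card B = card A" "finite B"
      using obtain_subset_with_card_n by metis
    moreover have "finite A" using eq \<open>A \<subseteq> X\<close> finite_subset by blast
    ultimately show ?thesis using eq \<open>A \<subseteq> X\<close>
      by (intro exI[of _ B]) (auto simp: same_upto_def card_Diff_subset)
  next
    case large
    \<comment> \<open>Either \<open>A\<close> or its complement can play the role of the small part \<open>C\<close>.\<close>
    have small: "\<exists>B\<subseteq>Y. finite B \<and> same_upto t C B \<and> same_upto t (X - C) (Y - B)"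
      if "C \<subseteq> X" "finite C" "card C < t" for C
    proof -
      have "infinite Y \<or> card C \<le> card Y" using large that(3) by auto
      then obtain B where B: "B \<subseteq> Y" "finite B" "card B = card C"
        using large_subset by metis
      have "infinite (X - C) \<or> t \<le> card (X - C)" "infinite (Y - B) \<or> t \<le> card (Y - B)"
        using large_Diff[OF large(1), of C] large_Diff[OF large(2), of B] that B by simp_all
      with B that(2) show ?thesis
        by (intro exI[of _ B]) (simp add: same_upto_def)
    qed
    consider "finite A" "card A < t" | "finite (X - A)" "card (X - A) < t"
      | "infinite A \<or> t \<le> card A" "infinite (X - A) \<or> t \<le> card (X - A)"
      using not_le by blast
    then show ?thesis
    proof cases
      case 1
      then show ?thesis using small[OF \<open>A \<subseteq> X\<close>] by blast
    next
      case 2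
      then obtain B where "B \<subseteq> Y" "finite B" "same_upto t (X - A) B"
          "same_upto t (X - (X - A)) (Y - B)"
        using small[of "X - A"] by auto
      moreover have "X - (X - A) = A" "Y - (Y - B) = B"
        using \<open>A \<subseteq> X\<close> \<open>B \<subseteq> Y\<close> by auto
      ultimately show ?thesis by (intro exI[of _ "Y - B"]) simp
    next
      case 3
      have "infinite Y \<or> t \<le> card Y" using large(2) by auto
      then obtain B where "B \<subseteq> Y" "finite B" "card B = t"
        using large_subset by metis
      moreover from this have "infinite (Y - B) \<or> t \<le> card (Y - B)"
        using large_Diff[OF large(2), of B] by simp
      ultimately show ?thesis using 3
        by (intro exI[of _ B]) (simp add: same_upto_def)
    qed
  qed
qed

lemma same_upto_inj:
  assumes "same_upto t X Y" "F \<subseteq> Y" "finite F" "card F \<le> t"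
  shows "\<exists>f. f ` F \<subseteq> X \<and> inj_on f F"
proof (cases "finite X \<and> card X < t")
  case True
  with assms(1) have "finite Y" "card X = card Y" by (auto simp: same_upto_def)
  with assms(2) have "card F \<le> card X" by (simp add: card_mono)
  with True assms(3) show ?thesis by (intro card_le_inj) auto
next
  case False
  then have "infinite X \<or> t \<le> card X" by auto
  then obtain G where "G \<subseteq> X" "finite G" "card G = t"
    by (rule large_subset)
  moreover from this obtain f where "f ` F \<subseteq> G" "inj_on f F"
    using card_le_inj[of F G] assms(3,4) by auto
  ultimately show ?thesis by blast
qed

section \<open>Transferring configurations between two structures\<close>

text \<open>Configurations are copied from \<open>D\<close> to \<open>D'\<close>; \<open>n\<close> will be the level of the existentially quantified
  variables.\<close>
locale two_structures =
  M: nf_structure D E + N: nf_structure D' E'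
  for D :: "'a set" and E and D' :: "'b set" and E' +
  fixes \<sigma> :: "var \<Rightarrow> nat" and n :: nat
begin

definition agree :: "var set \<Rightarrow> (var \<Rightarrow> 'a) \<Rightarrow> (var \<Rightarrow> 'b) \<Rightarrow> bool" where
  "agree V v w \<longleftrightarrow> (\<forall>x\<in>V. \<forall>y\<in>V.
     (\<sigma> y = Suc (\<sigma> x) \<longrightarrow> (E (v x) (v y) \<longleftrightarrow> E' (w x) (w y))) \<and>
     (\<sigma> y = \<sigma> x \<longrightarrow> (v x = v y \<longleftrightarrow> w x = w y)))"

definition similar :: "nat \<Rightarrow> var set \<Rightarrow> (var \<Rightarrow> 'a) \<Rightarrow> (var \<Rightarrow> 'b) \<Rightarrow> bool" where
  "similar t V v w \<longleftrightarrow> (\<forall>P. same_upto t (cell D E \<sigma> n V v P) (cell D' E' \<sigma> n V w P))"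

lemma agree_Mem: "agree V v w \<Longrightarrow> x \<in> V \<Longrightarrow> y \<in> V \<Longrightarrow> \<sigma> y = Suc (\<sigma> x) \<Longrightarrow>
    E (v x) (v y) \<longleftrightarrow> E' (w x) (w y)"
  by (simp add: agree_def)

lemma agree_Eq: "agree V v w \<Longrightarrow> x \<in> V \<Longrightarrow> y \<in> V \<Longrightarrow> \<sigma> y = \<sigma> x \<Longrightarrow> v x = v y \<longleftrightarrow> w x = w y"
  by (simp add: agree_def)

lemma sat_agree:
  "quantifier_free p \<Longrightarrow> stratification \<sigma> p \<Longrightarrow> fv p \<subseteq> V \<Longrightarrow> agree V v w \<Longrightarrow>
    sat D E v p \<longleftrightarrow> sat D' E' w p"
proof (induction p)
  case (Mem x y)
  then show ?case using agree_Mem[of V v w x y] by (simp add: stratification_def)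
next
  case (Eq x y)
  then show ?case using agree_Eq[of V v w x y] by (simp add: stratification_def)
next
  case (Neg p)
  then show ?case by (simp add: stratification_def)
next
  case (Imp p q)
  then show ?case by (simp add: stratification_def)
qed simp

lemma agree_insert:
  assumes V: "agree V v w" "z \<notin> V" "\<forall>x\<in>V. \<sigma> x \<le> \<sigma> z"
    and Mem: "\<And>x. x \<in> V \<Longrightarrow> \<sigma> z = Suc (\<sigma> x) \<Longrightarrow> E (v x) (v z) \<longleftrightarrow> E' (w x) d"
    and Eq: "\<And>x. x \<in> V \<Longrightarrow> \<sigma> x = \<sigma> z \<Longrightarrow> v x = v z \<longleftrightarrow> w x = d"
  shows "agree (insert z V) v (w(z := d))"
  unfolding agree_def
proof (intro ballI)
  fix x y assume "x \<in> insert z V" "y \<in> insert z V"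
  then consider "x = z" "y = z" | "x = z" "y \<in> V" "y \<noteq> z" | "x \<in> V" "y = z" "x \<noteq> z"
    | "x \<in> V" "y \<in> V" "x \<noteq> z" "y \<noteq> z"
    using V(2) by blast
  then show "(\<sigma> y = Suc (\<sigma> x) \<longrightarrow> (E (v x) (v y) \<longleftrightarrow> E' ((w(z := d)) x) ((w(z := d)) y))) \<and>
     (\<sigma> y = \<sigma> x \<longrightarrow> (v x = v y \<longleftrightarrow> (w(z := d)) x = (w(z := d)) y))"
  proof cases
    case 1
    then show ?thesis by simp
  next
    case 2
    then have "\<sigma> y \<le> \<sigma> z" using V(3) by blast
    with 2 Eq[of y] show ?thesis by auto
  next
    case 3
    with Mem[of x] Eq[of x] show ?thesis by simp
  next
    case 4
    with agree_Mem[OF V(1)] agree_Eq[OF V(1)] show ?thesis by simp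
  qed
qed

text \<open>If the value of \<open>z\<close> is shared by an earlier variable there is nothing to choose. Otherwise infinitely
  many elements have the required trace on the copied values one level below, and finitely many of them
  are excluded as values of earlier variables.\<close>
lemma agree_extend:
  assumes V: "agree V v w" "finite V" "z \<notin> V" "\<forall>x\<in>V. \<sigma> x \<le> \<sigma> z" and w: "range w \<subseteq> D'"
  shows "\<exists>d\<in>D'. agree (insert z V) v (w(z := d))"
proof (cases "\<exists>x\<in>V. \<sigma> x = \<sigma> z \<and> v x = v z")
  case True
  then obtain y where y: "y \<in> V" "\<sigma> y = \<sigma> z" "v y = v z" by blast
  have "agree (insert z V) v (w(z := w y))"
  proof (rule agree_insert[OF V(1,3,4)])
    show "E (v x) (v z) \<longleftrightarrow> E' (w x) (w y)" if "x \<in> V" "\<sigma> z = Suc (\<sigma> x)" for x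
      using agree_Mem[OF V(1), of x y] y that by simp
    show "v x = v z \<longleftrightarrow> w x = w y" if "x \<in> V" "\<sigma> x = \<sigma> z" for x
      using agree_Eq[OF V(1), of x y] y that by simp
  qed
  moreover have "w y \<in> D'" using w by blast
  ultimately show ?thesis by blast
next
  case False
  define L where "L = {x \<in> V. Suc (\<sigma> x) = \<sigma> z}"
  define T where "T = w ` {x \<in> L. E (v x) (v z)}"
  have "infinite {d \<in> D'. extent D' E' d \<inter> w ` L = T}"
    using V(2) w by (intro N.infinite_trace) (auto simp: L_def T_def)
  then have "infinite ({d \<in> D'. extent D' E' d \<inter> w ` L = T} - w ` V)"
    using V(2) by simp
  then have "{d \<in> D'. extent D' E' d \<inter> w ` L = T} - w ` V \<noteq> {}"
    by (rule infinite_imp_nonempty)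
  then obtain d where d: "d \<in> D'" "extent D' E' d \<inter> w ` L = T" "d \<notin> w ` V"
    by auto
  have "agree (insert z V) v (w(z := d))"
  proof (rule agree_insert[OF V(1,3,4)])
    fix x assume x: "x \<in> V" "\<sigma> z = Suc (\<sigma> x)"
    then have "x \<in> L" by (simp add: L_def)
    then have "E' (w x) d \<longleftrightarrow> w x \<in> T"
      using d(2) w unfolding extent_def by blast
    also have "\<dots> \<longleftrightarrow> E (v x) (v z)"
    proof
      assume "w x \<in> T"
      then obtain y where "y \<in> L" "E (v y) (v z)" "w x = w y" by (auto simp: T_def)
      moreover from this have "v x = v y"
        using agree_Eq[OF V(1), of x y] \<open>x \<in> L\<close> by (auto simp: L_def)
      ultimately show "E (v x) (v z)" by simp
    next
      assume "E (v x) (v z)"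
      with \<open>x \<in> L\<close> show "w x \<in> T" by (auto simp: T_def)
    qed
    finally show "E (v x) (v z) \<longleftrightarrow> E' (w x) d" by simp
  next
    fix x assume "x \<in> V" "\<sigma> x = \<sigma> z"
    with False d(3) show "v x = v z \<longleftrightarrow> w x = d" by auto
  qed
  with d(1) show ?thesis by blast
qed

lemma profile_agree:
  assumes "agree V v w" "u \<in> V" "\<sigma> u = n"
  shows "profile E \<sigma> n V v (v u) = profile E' \<sigma> n V w (w u)"
proof -
  have "Suc (\<sigma> x) = n \<and> E (v x) (v u) \<or> \<sigma> x = n \<and> v x = v u \<or> \<sigma> x = Suc n \<and> E (v u) (v x) \<longleftrightarrow>
      Suc (\<sigma> x) = n \<and> E' (w x) (w u) \<or> \<sigma> x = n \<and> w x = w u \<or> \<sigma> x = Suc n \<and> E' (w u) (w x)"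
    if "x \<in> V" for x
    using agree_Mem[OF assms(1) that assms(2)] agree_Mem[OF assms(1,2) that]
      agree_Eq[OF assms(1) that assms(2)] assms(3) by auto
  then show ?thesis unfolding profile_def by blast
qed

text \<open>Cells are singletons, empty or infinite here, and which of these holds can be read off from atomic
  facts (\<open>cell_at_value\<close>, \<open>low_cell\<close>).\<close>
lemma similar_low:
  assumes V: "agree V v w" "finite V" "\<forall>x\<in>V. \<sigma> x \<le> n"
    and ranges: "range v \<subseteq> D" "range w \<subseteq> D'"
  shows "similar t V v w"
  unfolding similar_def
proof
  fix P
  let ?X = "cell D E \<sigma> n V v P" and ?Y = "cell D' E' \<sigma> n V w P"
  show "same_upto t ?X ?Y"
  proof (cases "\<exists>u\<in>V. \<sigma> u = n \<and> u \<in> P")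
    case True
    then obtain u where u: "u \<in> V" "\<sigma> u = n" "u \<in> P" by blast
    have "v u \<in> D" "w u \<in> D'" using ranges by blast+
    with M.cell_at_value[of u V \<sigma> n P v] N.cell_at_value[of u V \<sigma> n P w] u profile_agree[OF V(1) u(1,2)]
    show ?thesis by (simp add: same_upto_def)
  next
    case False
    let ?L = "{u \<in> V. Suc (\<sigma> u) = n}"
    have *: "\<forall>u\<in>V. \<sigma> u = n \<longrightarrow> u \<notin> P" using False by blast
    have "P \<subseteq> ?L \<and> (\<forall>u\<in>P. \<forall>u'\<in>?L. v u = v u' \<longrightarrow> u' \<in> P) \<longleftrightarrow>
        P \<subseteq> ?L \<and> (\<forall>u\<in>P. \<forall>u'\<in>?L. w u = w u' \<longrightarrow> u' \<in> P)"
    proof (rule conj_cong[OF refl])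
      assume "P \<subseteq> ?L"
      have "v u = v u' \<longleftrightarrow> w u = w u'" if "u \<in> P" "u' \<in> ?L" for u u'
      proof (rule agree_Eq[OF V(1)])
        have "u \<in> ?L" using \<open>P \<subseteq> ?L\<close> that(1) by blast
        with that(2) show "u \<in> V" "u' \<in> V" "\<sigma> u' = \<sigma> u" by auto
      qed
      then show "(\<forall>u\<in>P. \<forall>u'\<in>?L. v u = v u' \<longrightarrow> u' \<in> P) \<longleftrightarrow>
          (\<forall>u\<in>P. \<forall>u'\<in>?L. w u = w u' \<longrightarrow> u' \<in> P)" by simp
    qed
    with M.low_cell[OF V(2) ranges(1) V(3) *] N.low_cell[OF V(2) ranges(2) V(3) *]
    show ?thesis
      by (auto simp: same_upto_def split: if_split_asm)
  qed
qed

text \<open>Each cell of the second structure is split as the value of \<open>z\<close> splits the corresponding cell of the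
  first one, and the chosen parts are united to the new value. That the new value satisfies the right
  atomic facts follows from the sizes alone: membership of a value of level \<open>n\<close> concerns a cell with one
  element, and equality with another value of level \<open>n + 1\<close> the emptiness of parts of
  cells. Both are visible since \<open>t\<close> is positive.\<close>
lemma similar_set:
  assumes V: "agree V v w" "finite V" "z \<notin> V" "\<forall>x\<in>V. \<sigma> x \<le> \<sigma> z" and z: "\<sigma> z = Suc n"
    and ranges: "range v \<subseteq> D" "range w \<subseteq> D'"
    and sim: "similar (2 * t) V v w" and "t > 0"
  shows "\<exists>d\<in>D'. agree (insert z V) v (w(z := d)) \<and> similar t (insert z V) v (w(z := d))"
proof -
  define X where "X P = cell D E \<sigma> n V v P" for P
  define Y where "Y P = cell D' E' \<sigma> n V w P" for P
  define A where "A = extent D E (v z)"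
  have "\<exists>B\<subseteq>Y P. (finite B \<or> finite (Y P - B)) \<and> same_upto t (X P \<inter> A) B \<and>
      same_upto t (X P - A) (Y P - B)" for P
  proof -
    have "same_upto (2 * t) (X P) (Y P)" using sim by (simp add: similar_def X_def Y_def)
    from same_upto_split[OF this, of "X P \<inter> A"] show ?thesis by (simp add: Diff_Int_distrib Diff_Int)
  qed
  then obtain B where B: "\<And>P. B P \<subseteq> Y P" "\<And>P. finite (B P) \<or> finite (Y P - B P)"
    "\<And>P. same_upto t (X P \<inter> A) (B P)" "\<And>P. same_upto t (X P - A) (Y P - B P)"
    by metis
  have Y: "Y P \<subseteq> D'" "internal D' E' (Y P)" for P
    using N.internal_cell[OF V(2) ranges(2)] N.internal_subset by (auto simp: Y_def)
  have "internal D' E' (B P)" for P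
    using B(2)[of P]
  proof
    assume "finite (B P)"
    then show ?thesis using N.internal_finite B(1) Y(1) by blast
  next
    assume "finite (Y P - B P)"
    then have "internal D' E' (D' - (Y P - B P))"
      using Y(1) by (intro N.internal_Compl N.internal_finite) auto
    then have "internal D' E' (Y P \<inter> (D' - (Y P - B P)))"
      by (rule N.internal_Int[OF Y(2)])
    moreover have "Y P \<inter> (D' - (Y P - B P)) = B P" using B(1)[of P] Y(1)[of P] by blast
    ultimately show ?thesis by simp
  qed
  then have "internal D' E' (\<Union>P\<in>Pow V. B P)"
    using V(2) by (intro N.internal_UN) auto
  then obtain d where d: "d \<in> D'" "extent D' E' d = (\<Union>P\<in>Pow V. B P)"
    unfolding internal_def by blast
  have Yd: "Y P \<inter> extent D' E' d = B P" for P
  proof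
    show "Y P \<inter> extent D' E' d \<subseteq> B P"
    proof
      fix b assume b: "b \<in> Y P \<inter> extent D' E' d"
      then obtain Q where "b \<in> B Q" using d(2) by blast
      with B(1)[of Q] have "b \<in> Y Q" by blast
      with b have "P = Q" by (simp add: Y_def cell_def)
      with \<open>b \<in> B Q\<close> show "b \<in> B P" by simp
    qed
    show "B P \<subseteq> Y P \<inter> extent D' E' d"
    proof
      fix b assume b: "b \<in> B P"
      with B(1)[of P] have "b \<in> Y P" by blast
      then have "P \<subseteq> V" by (auto simp: Y_def cell_def profile_def)
      with b \<open>b \<in> Y P\<close> show "b \<in> Y P \<inter> extent D' E' d" using d(2) by blast
    qed
  qed
  then have Yd': "Y P - extent D' E' d = Y P - B P" for P by blast
  have in_iff: "X P \<inter> A = {} \<longleftrightarrow> Y P \<inter> extent D' E' d = {}" for P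
    using same_upto_empty_iff[OF B(3) \<open>t > 0\<close>, of P] Yd by simp
  have out_iff: "X P - A = {} \<longleftrightarrow> Y P - extent D' E' d = {}" for P
    using same_upto_empty_iff[OF B(4) \<open>t > 0\<close>, of P] Yd' by simp
  have "agree (insert z V) v (w(z := d))"
  proof (rule agree_insert[OF V(1,3,4)])
    fix x assume x: "x \<in> V" "\<sigma> z = Suc (\<sigma> x)"
    then have n: "\<sigma> x = n" using z by simp
    define P where "P = profile E \<sigma> n V v (v x)"
    have "x \<in> P" using x n by (simp add: P_def profile_def)
    have D: "v x \<in> D" "w x \<in> D'" using ranges by blast+
    have "X P = {v x}" "Y P = {w x}"
      using M.cell_at_value[of x V \<sigma> n P v] N.cell_at_value[of x V \<sigma> n P w] x(1) n \<open>x \<in> P\<close> D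
        profile_agree[OF V(1) x(1) n] by (simp_all add: X_def Y_def P_def)
    with in_iff[of P] D show "E (v x) (v z) \<longleftrightarrow> E' (w x) d"
      by (simp add: A_def extent_def)
  next
    fix x assume x: "x \<in> V" "\<sigma> x = \<sigma> z"
    then have n: "\<sigma> x = Suc n" using z by simp
    have D: "v x \<in> D" "v z \<in> D" "w x \<in> D'" using ranges by blast+
    show "v x = v z \<longleftrightarrow> w x = d"
      using M.eq_iff_cells[of x V \<sigma> n v "v z"] N.eq_iff_cells[of x V \<sigma> n w d] x(1) n D d(1)
        in_iff out_iff by (simp add: X_def Y_def A_def)
  qed
  moreover have "similar t (insert z V) v (w(z := d))"
    unfolding similar_def
  proof
    fix P
    have upd: "cell D' E' \<sigma> n V (w(z := d)) Q = Y Q" for Q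
      unfolding Y_def by (rule cell_cong) (use V(3) in auto)
    show "same_upto t (cell D E \<sigma> n (insert z V) v P)
        (cell D' E' \<sigma> n (insert z V) (w(z := d)) P)"
      unfolding M.cell_insert_set[of z V \<sigma> n, OF V(3) z] N.cell_insert_set[of z V \<sigma> n, OF V(3) z] upd
      using B(3,4) Yd Yd' by (simp add: X_def A_def)
  qed
  ultimately show ?thesis using d(1) by blast
qed

lemma similar_above:
  assumes "similar t V v w" "z \<notin> V" "\<sigma> z > Suc n"
  shows "similar t (insert z V) v (w(z := d))"
proof -
  have "cell D' E' \<sigma> n V (w(z := d)) P = cell D' E' \<sigma> n V w P" for P
    by (rule cell_cong) (use assms(2) in auto)
  then show ?thesis
    using assms(1) M.cell_insert_above[of n \<sigma> z] N.cell_insert_above[of n \<sigma> z] assms(3)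
    by (simp add: similar_def)
qed

text \<open>The bound is quantified inside the induction because each variable of level \<open>n + 1\<close> consumes
  half of it.\<close>
lemma ex_similar:
  assumes "finite V" "range v \<subseteq> D"
  shows "\<forall>t>0. \<exists>w. range w \<subseteq> D' \<and> agree V v w \<and> similar t V v w"
  using assms(1)
proof (induction V rule: finite_ranking_induct[where f = \<sigma>])
  case empty
  obtain d where "d \<in> D'" using N.nonempty by blast
  moreover have "agree {} v (\<lambda>_. d)" by (simp add: agree_def)
  ultimately have d: "range (\<lambda>_ :: var. d) \<subseteq> D'" "agree {} v (\<lambda>_. d)" by simp_all
  then have "similar t {} v (\<lambda>_. d)" for t
    by (intro similar_low assms(2)) simp_all
  with d have "\<exists>w. range w \<subseteq> D' \<and> agree {} v w \<and> similar t {} v w" for t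
    by (intro exI[of _ "\<lambda>_. d"]) simp
  then show ?case by blast
next
  case (insert z V)
  show ?case
  proof (cases "z \<in> V")
    case True
    with insert.IH show ?thesis by (simp add: insert_absorb)
  next
    case False
    have top: "\<forall>x\<in>V. \<sigma> x \<le> \<sigma> z" using insert.hyps by blast
    show ?thesis
    proof (intro allI impI)
      fix t :: nat assume "t > 0"
      then obtain w where w: "range w \<subseteq> D'" "agree V v w" "similar (2 * t) V v w"
        using insert.IH[rule_format, of "2 * t"] by auto
      obtain w' where w': "range w' \<subseteq> D'" "agree V v w'" "similar t V v w'"
        using insert.IH \<open>t > 0\<close> by blast
      consider "\<sigma> z \<le> n" | "\<sigma> z = Suc n" | "\<sigma> z > Suc n" by linarith
      then have "\<exists>w. \<exists>d\<in>D'. range w \<subseteq> D' \<and> agree (insert z V) v (w(z := d)) \<and>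
          similar t (insert z V) v (w(z := d))"
      proof cases
        case 1
        obtain d where d: "d \<in> D'" "agree (insert z V) v (w(z := d))"
          using agree_extend[OF w(2) insert.hyps(1) False top w(1)] by blast
        moreover have "similar t (insert z V) v (w(z := d))"
          using insert.hyps(1) top 1 assms(2) w(1) d(1) by (intro similar_low[OF d(2)]) auto
        ultimately show ?thesis using w(1) by blast
      next
        case 2
        show ?thesis
          using similar_set[OF w(2) insert.hyps(1) False top 2 assms(2) w(1,3) \<open>t > 0\<close>] w(1)
          by blast
      next
        case 3
        show ?thesis
          using agree_extend[OF w'(2) insert.hyps(1) False top w'(1)] w'(1)
            similar_above[OF w'(3) False 3] by blast
      qed
      then obtain w d where "d \<in> D'" "range w \<subseteq> D'" "agree (insert z V) v (w(z := d))"
          "similar t (insert z V) v (w(z := d))"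
        by blast
      moreover from this have "range (w(z := d)) \<subseteq> D'" by auto
      ultimately show "\<exists>w. range w \<subseteq> D' \<and> agree (insert z V) v w \<and> similar t (insert z V) v w"
        by blast
    qed
  qed
qed

text \<open>An answer \<open>w'\<close> in the second structure is pulled back cell by cell: it uses at most \<open>t\<close> elements of
  a cell, and the corresponding cell of the first structure has enough room for an injective copy.
  Keeping the profiles preserves the atomic facts between old and new variables, injectivity the
  equations between new ones.\<close>
lemma answer_witnesses:
  assumes V: "agree V v w" "similar t V v w" "card Y \<le> t"
    and Y: "finite Y" "Y \<inter> V = {}" "\<forall>y\<in>Y. \<sigma> y = n"
    and w': "\<forall>u. u \<notin> Y \<longrightarrow> w' u = w u" "\<forall>y\<in>Y. w' y \<in> D'"
  shows "\<exists>v'. (\<forall>u. u \<notin> Y \<longrightarrow> v' u = v u) \<and> (\<forall>y\<in>Y. v' y \<in> D) \<and> agree (V \<union> Y) v' w'"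
proof -
  let ?p = "profile E \<sigma> n V v" and ?q = "profile E' \<sigma> n V w"
  define F where "F P = w' ` Y \<inter> cell D' E' \<sigma> n V w P" for P
  have "\<exists>f. f ` F P \<subseteq> cell D E \<sigma> n V v P \<and> inj_on f (F P)" for P
  proof (rule same_upto_inj)
    show "same_upto t (cell D E \<sigma> n V v P) (cell D' E' \<sigma> n V w P)"
      using V(2) by (simp add: similar_def)
    show "F P \<subseteq> cell D' E' \<sigma> n V w P" "finite (F P)" using Y(1) by (auto simp: F_def)
    have "card (F P) \<le> card (w' ` Y)" using Y(1) by (intro card_mono) (auto simp: F_def)
    also have "\<dots> \<le> card Y" using Y(1) by (rule card_image_le)
    also have "\<dots> \<le> t" by (rule V(3))
    finally show "card (F P) \<le> t" .
  qed
  then obtain f where f: "\<And>P. f P ` F P \<subseteq> cell D E \<sigma> n V v P" "\<And>P. inj_on (f P) (F P)"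
    by metis
  define v' where "v' u = (if u \<in> Y then f (?q (w' u)) (w' u) else v u)" for u
  have F: "w' y \<in> F (?q (w' y))" if "y \<in> Y" for y
    using that w'(2) by (simp add: F_def cell_def)
  have v': "v' y \<in> D \<and> ?p (v' y) = ?q (w' y)" if "y \<in> Y" for y
    using f(1)[of "?q (w' y)"] F[OF that] that by (auto simp: v'_def cell_def)
  have inj: "v' y = v' z \<longleftrightarrow> w' y = w' z" if "y \<in> Y" "z \<in> Y" for y z
  proof
    assume eq: "v' y = v' z"
    then have P: "?q (w' y) = ?q (w' z)" using v' that by metis
    with eq that have "f (?q (w' z)) (w' y) = f (?q (w' z)) (w' z)" by (simp add: v'_def)
    then show "w' y = w' z"
      using f(2)[of "?q (w' z)"] F[OF that(1)] F[OF that(2)] P by (auto dest: inj_onD)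
  next
    assume "w' y = w' z"
    with that show "v' y = v' z" by (simp add: v'_def)
  qed
  have old: "v' u = v u" "w' u = w u" "u \<notin> Y" if "u \<in> V" for u
    using that Y(2) w'(1) by (auto simp: v'_def)
  have below: "E (v u) (v' y) \<longleftrightarrow> E' (w u) (w' y)" if "u \<in> V" "y \<in> Y" "Suc (\<sigma> u) = n" for u y
  proof -
    have "u \<in> ?p (v' y) \<longleftrightarrow> u \<in> ?q (w' y)" using v'[OF that(2)] by simp
    with that show ?thesis by (simp add: profile_def)
  qed
  have above: "E (v' y) (v u) \<longleftrightarrow> E' (w' y) (w u)" if "u \<in> V" "y \<in> Y" "\<sigma> u = Suc n" for u y
  proof -
    have "u \<in> ?p (v' y) \<longleftrightarrow> u \<in> ?q (w' y)" using v'[OF that(2)] by simp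
    with that show ?thesis by (simp add: profile_def)
  qed
  have equal: "v u = v' y \<longleftrightarrow> w u = w' y" if "u \<in> V" "y \<in> Y" "\<sigma> u = n" for u y
  proof -
    have "u \<in> ?p (v' y) \<longleftrightarrow> u \<in> ?q (w' y)" using v'[OF that(2)] by simp
    with that show ?thesis by (simp add: profile_def)
  qed
  have "agree (V \<union> Y) v' w'"
    unfolding agree_def
  proof (intro ballI)
    fix x y assume "x \<in> V \<union> Y" "y \<in> V \<union> Y"
    then consider "x \<in> V" "y \<in> V" | "x \<in> V" "y \<in> Y" | "x \<in> Y" "y \<in> V" | "x \<in> Y" "y \<in> Y"
      by blast
    then show "(\<sigma> y = Suc (\<sigma> x) \<longrightarrow> (E (v' x) (v' y) \<longleftrightarrow> E' (w' x) (w' y))) \<and>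
        (\<sigma> y = \<sigma> x \<longrightarrow> (v' x = v' y \<longleftrightarrow> w' x = w' y))"
    proof cases
      case 1
      with old agree_Mem[OF V(1)] agree_Eq[OF V(1)] show ?thesis by simp
    next
      case 2
      with old(1,2)[of x] below[of x y] equal[of x y] Y(3) show ?thesis by auto
    next
      case 3
      with old(1,2)[of y] above[of y x] equal[of y x] Y(3) show ?thesis by auto
    next
      case 4
      with inj[of x y] Y(3) show ?thesis by simp
    qed
  qed
  moreover have "\<forall>u. u \<notin> Y \<longrightarrow> v' u = v u" by (simp add: v'_def)
  ultimately show ?thesis using v' by blast
qed

end

section \<open>Blocks of quantifiers\<close>

lemma sat_Existss:
  "sat D E v (Existss ys p) \<longleftrightarrow>
    (\<exists>v'. (\<forall>u. u \<notin> set ys \<longrightarrow> v' u = v u) \<and> (\<forall>y\<in>set ys. v' y \<in> D) \<and> sat D E v' p)"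
proof (induction ys arbitrary: v)
  case Nil
  have "v' = v" if "\<forall>u. v' u = v u" for v' using that by auto
  then show ?case by auto
next
  case (Cons y ys)
  have "sat D E v (Existss (y # ys) p) \<longleftrightarrow> (\<exists>a\<in>D. sat D E (v(y := a)) (Existss ys p))"
    by simp
  also have "\<dots> \<longleftrightarrow> (\<exists>a\<in>D. \<exists>v'. (\<forall>u. u \<notin> set ys \<longrightarrow> v' u = (v(y := a)) u) \<and>
      (\<forall>z\<in>set ys. v' z \<in> D) \<and> sat D E v' p)"
    unfolding Cons.IH ..
  also have "\<dots> \<longleftrightarrow> (\<exists>v'. (\<forall>u. u \<notin> set (y # ys) \<longrightarrow> v' u = v u) \<and>
      (\<forall>z\<in>set (y # ys). v' z \<in> D) \<and> sat D E v' p)" (is "?L \<longleftrightarrow> ?R")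
  proof
    assume ?L
    then obtain a v' where "a \<in> D" and v': "\<forall>u. u \<notin> set ys \<longrightarrow> v' u = (v(y := a)) u"
      "\<forall>z\<in>set ys. v' z \<in> D" "sat D E v' p" by blast
    then have "\<forall>u. u \<notin> set (y # ys) \<longrightarrow> v' u = v u" "v' y \<in> D"
      by (simp, cases "y \<in> set ys") simp_all
    with v'(2,3) show ?R by (intro exI[of _ v']) simp
  next
    assume ?R
    then obtain v' where "\<forall>u. u \<notin> set (y # ys) \<longrightarrow> v' u = v u"
      "\<forall>z\<in>set (y # ys). v' z \<in> D" "sat D E v' p" by blast
    then show ?L by (intro bexI[of _ "v' y"] exI[of _ v']) simp_all
  qed
  finally show ?case .
qed

lemma sat_Foralls:
  "sat D E v (Foralls xs p) \<longleftrightarrow>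
    (\<forall>v'. (\<forall>u. u \<notin> set xs \<longrightarrow> v' u = v u) \<longrightarrow> (\<forall>x\<in>set xs. v' x \<in> D) \<longrightarrow> sat D E v' p)"
proof -
  have "sat D E v (Foralls xs p) \<longleftrightarrow> \<not> sat D E v (Existss xs (Neg p))" for v
    by (induction xs arbitrary: v) simp_all
  then show ?thesis unfolding sat_Existss by auto
qed

lemma fv_Foralls: "fv (Foralls xs p) = fv p - set xs"
  by (induction xs) auto

lemma fv_Existss: "fv (Existss ys p) = fv p - set ys"
  by (induction ys) auto

lemma subformulas_prefix: "subformulas p \<subseteq> subformulas (Foralls xs (Existss ys p))"
proof -
  have "subformulas p \<subseteq> subformulas (Existss ys p)" by (induction ys) auto
  also have "\<dots> \<subseteq> subformulas (Foralls xs (Existss ys p))" by (induction xs) auto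
  finally show ?thesis .
qed

text \<open>A counterexample in the first structure is copied to the second one, where the sentence provides
  witnesses; these are pulled back.\<close>
lemma (in two_structures) transfer:
  assumes \<theta>: "quantifier_free \<theta>" "stratification \<sigma> \<theta>"
    and ys: "\<forall>y\<in>set ys. \<sigma> y = n" and fv: "fv \<theta> - set ys \<subseteq> set xs"
    and ranges: "range v0 \<subseteq> D" "range w0 \<subseteq> D'"
    and sat: "sat D' E' w0 (Foralls xs (Existss ys \<theta>))"
  shows "sat D E v0 (Foralls xs (Existss ys \<theta>))"
  unfolding sat_Foralls
proof (intro allI impI)
  fix v assume v: "\<forall>u. u \<notin> set xs \<longrightarrow> v u = v0 u" "\<forall>x\<in>set xs. v x \<in> D"
  have "v u \<in> D" for u using v ranges(1) by (cases "u \<in> set xs") auto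
  then have v_range: "range v \<subseteq> D" by blast
  let ?V = "fv \<theta> - set ys" and ?t = "Suc (card (set ys))"
  have "finite ?V" using finite_vars fv_subset_vars finite_subset by blast
  from ex_similar[OF this v_range] obtain w where
    w: "range w \<subseteq> D'" "agree ?V v w" "similar ?t ?V v w" by blast
  have "sat D' E' w (Existss ys \<theta>)"
  proof -
    define w1 where "w1 u = (if u \<in> set xs then w u else w0 u)" for u
    have "sat D' E' w1 (Existss ys \<theta>)"
    proof (rule sat[unfolded sat_Foralls, rule_format])
      show "w1 u = w0 u" if "u \<notin> set xs" for u using that by (simp add: w1_def)
      show "w1 x \<in> D'" if "x \<in> set xs" for x using that w(1) by (auto simp: w1_def)
    qed
    moreover have "sat D' E' w1 (Existss ys \<theta>) \<longleftrightarrow> sat D' E' w (Existss ys \<theta>)"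
      by (rule sat_cong) (use fv in \<open>auto simp: fv_Existss w1_def\<close>)
    ultimately show ?thesis by simp
  qed
  then obtain w' where w': "\<forall>u. u \<notin> set ys \<longrightarrow> w' u = w u" "\<forall>y\<in>set ys. w' y \<in> D'"
      "sat D' E' w' \<theta>"
    unfolding sat_Existss by blast
  obtain v' where v': "\<forall>u. u \<notin> set ys \<longrightarrow> v' u = v u" "\<forall>y\<in>set ys. v' y \<in> D"
      "agree (?V \<union> set ys) v' w'"
    using answer_witnesses[OF w(2,3), of "set ys" w'] ys w'(1,2) by auto
  have "sat D E v' \<theta> \<longleftrightarrow> sat D' E' w' \<theta>"
    by (rule sat_agree[OF \<theta> _ v'(3)]) auto
  with v' w'(3) show "sat D E v (Existss ys \<theta>)"
    unfolding sat_Existss by blast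
qed

section \<open>Models of NF\<close>

text \<open>Comprehension with two parameters, which covers all instances that are needed.\<close>
lemma NF_internal:
  assumes NF: "\<forall>p\<in>NF. sat D E v p" and p: "stratified p" "fv p \<subseteq> {0, 1, 2}"
    and ab: "a \<in> D" "b \<in> D"
  shows "internal D E {x \<in> D. sat D E (v(0 := a, 1 := b, 2 := x)) p}"
proof -
  have "Foralls [0, 1] (Exists 3 (Forall 2 (Iff (Mem 2 3) p))) \<in> stratified_comprehension"
    unfolding stratified_comprehension_def using p
    by (intro CollectI exI[of _ "[0, 1]"] exI[of _ 2] exI[of _ 3] exI[of _ p]) auto
  then have "sat D E v (Foralls [0, 1] (Exists 3 (Forall 2 (Iff (Mem 2 3) p))))"
    using NF unfolding NF_def by blast
  then have "\<forall>a\<in>D. \<forall>b\<in>D. \<exists>c\<in>D. \<forall>x\<in>D.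
      E x c \<longleftrightarrow> sat D E (v(0 := a, 1 := b, 3 := c, 2 := x)) p"
    by (simp add: iff_conv_conj_imp)
  with ab obtain c where c: "c \<in> D"
    "\<forall>x\<in>D. E x c \<longleftrightarrow> sat D E (v(0 := a, 1 := b, 3 := c, 2 := x)) p"
    by blast
  have "sat D E (v(0 := a, 1 := b, 3 := c, 2 := x)) p \<longleftrightarrow> sat D E (v(0 := a, 1 := b, 2 := x)) p"
    for x
    by (rule sat_cong) (use p(2) in auto)
  with c have "extent D E c = {x \<in> D. sat D E (v(0 := a, 1 := b, 2 := x)) p}"
    by (auto simp: extent_def)
  with c(1) show ?thesis unfolding internal_def by blast
qed

lemma stratifiedI: "stratification \<sigma> p \<Longrightarrow> stratified p"
  by (auto simp: stratified_def)

lemma nf_structure_if_model: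
  assumes NF: "\<forall>p\<in>NF. sat D E v p" and "D \<noteq> {}"
  shows "nf_structure D E"
proof
  note comp = NF_internal[OF NF]
  show "D \<noteq> {}" by fact
  show "a = b" if "a \<in> D" "b \<in> D" "extent D E a = extent D E b" for a b
  proof -
    have "sat D E v extensionality" using NF by (simp add: NF_def)
    with that(1,2) have "a = b \<longleftrightarrow> (\<forall>z\<in>D. E z a \<longleftrightarrow> E z b)"
      by (auto simp: extensionality_def)
    with that(3) show ?thesis by (auto simp: extent_def)
  qed
  show "internal D E {a}" if "a \<in> D" for a
  proof -
    have "stratified (Eq 2 0)"
      by (rule stratifiedI[of "\<lambda>_. 0"]) (simp add: stratification_def)
    from comp[OF this _ that that] have "internal D E {x \<in> D. x = a}" by simp
    moreover have "{x \<in> D. x = a} = {a}" using that by blast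
    ultimately show ?thesis by simp
  qed
  show "internal D E {y \<in> D. E a y}" if "a \<in> D" for a
  proof -
    have "stratified (Mem 0 2)"
      by (rule stratifiedI[of "\<lambda>x. if x = 0 then 0 else 1"]) (simp add: stratification_def)
    from comp[OF this _ that that] show ?thesis by simp
  qed
  show "internal D E (D - X)" if "internal D E X" for X
  proof -
    from that obtain a where a: "a \<in> D" "extent D E a = X" by (auto simp: internal_def)
    have "stratified (Neg (Mem 2 0))"
      by (rule stratifiedI[of "\<lambda>x. if x = 0 then 1 else 0"]) (simp add: stratification_def)
    from comp[OF this _ a(1) a(1)] have "internal D E {x \<in> D. \<not> E x a}" by simp
    moreover have "{x \<in> D. \<not> E x a} = D - X" using a(2) by (auto simp: extent_def)
    ultimately show ?thesis by simp
  qed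
  show "internal D E (X \<union> Y)" if "internal D E X" "internal D E Y" for X Y
  proof -
    from that obtain a b where a: "a \<in> D" "extent D E a = X" and b: "b \<in> D" "extent D E b = Y"
      by (auto simp: internal_def)
    have "stratified (Imp (Neg (Mem 2 0)) (Mem 2 1))"
      by (rule stratifiedI[of "\<lambda>x. if x = 2 then 0 else 1"]) (simp add: stratification_def)
    from comp[OF this _ a(1) b(1)] have "internal D E {x \<in> D. \<not> E x a \<longrightarrow> E x b}" by simp
    moreover have "{x \<in> D. \<not> E x a \<longrightarrow> E x b} = X \<union> Y"
      using a(2) b(2) by (auto simp: extent_def)
    ultimately show ?thesis by simp
  qed
qed

lemma NF_sentences: "theory_of_sentences NF"
proof
  have "sentence extensionality" by (auto simp: sentence_def extensionality_def)
  then show "sentence p" if "p \<in> NF" for p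
    using that by (auto simp: NF_def stratified_comprehension_def sentence_def fv_Foralls)
qed

theorem corollary4p20:
  fixes xs ys :: "var list" and \<theta> \<phi> :: fm and \<sigma> :: "var \<Rightarrow> nat"
  assumes "\<phi> = Foralls xs (Existss ys \<theta>)"
    and "quantifier_free \<theta>"
    and "sentence \<phi>"
    and "stratification \<sigma> \<phi>"
    and "\<forall>y \<in> set ys. \<forall>y' \<in> set ys. \<sigma> y = \<sigma> y'"
  shows "decides NF \<phi>"
proof (rule ccontr)
  interpret theory_of_sentences NF by (rule NF_sentences)
  assume "\<not> decides NF \<phi>"
  then have "consistent \<phi>" "consistent (Neg \<phi>)"
    unfolding decides_def consistent_def using derives_neg_neg ImpE by blast+
  from completeness[OF this(2)] obtain E :: "nat \<Rightarrow> nat \<Rightarrow> bool" and v where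
    M: "\<forall>p\<in>NF. sat (range v) E v p" "sat (range v) E v (Neg \<phi>)" by blast
  from completeness[OF \<open>consistent \<phi>\<close>] obtain E' :: "nat \<Rightarrow> nat \<Rightarrow> bool" and w where
    N: "\<forall>p\<in>NF. sat (range w) E' w p" "sat (range w) E' w \<phi>" by blast
  have "nf_structure (range v) E" "nf_structure (range w) E'"
    by (rule nf_structure_if_model[OF M(1)], blast) (rule nf_structure_if_model[OF N(1)], blast)
  then have structures: "two_structures (range v) E (range w) E'"
    by (rule two_structures.intro)
  have "\<forall>y\<in>set ys. \<sigma> y = \<sigma> (hd ys)"
    using assms(5) by (metis hd_in_set empty_iff set_empty)
  then obtain n where n: "\<forall>y\<in>set ys. \<sigma> y = n" ..
  interpret two_structures "range v" E "range w" E' \<sigma> n by (rule structures)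
  have "stratification \<sigma> \<theta>"
    using assms(1,4) subformulas_prefix[of \<theta> xs ys] unfolding stratification_def by blast
  moreover have "fv \<theta> - set ys \<subseteq> set xs"
    using assms(1,3) by (simp add: sentence_def fv_Foralls fv_Existss)
  ultimately have "sat (range v) E v \<phi>"
    using transfer[of \<theta> ys xs v w] n assms(1,2) N(2) by simp
  with M(2) show False by simp
qed

end
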